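(* Let $V$ be a non-discrete valuation domain of rank one with quotient field $K$, associated valuation $v$ and value group $\Gamma_v\subseteq\mathbb{R}$. Let $u$ be a fixed extension of $v$ to an algebraic closure $\overline{K}$ of $K$, let $\beta\in\overline{K}$ be a fixed element, and let $\delta(\beta,K)=\sup\{u(\beta-x)\mid x\in K\}$. The map $$\Sigma_\beta\colon\mathcal{V}^u(\beta,\bullet)\longrightarrow(-\infty,\delta(\beta,K)],\qquad V_E\longmapsto\delta_E,$$ is a homeomorphism between $\mathcal{V}^u(\beta,\bullet)$, endowed with the Zariski topology, and $(-\infty,\delta(\beta,K)]_{\mathbb{Q}\Gamma_v}$, i.e., the interval $(-\infty,\delta(\beta,K)]$ endowed with the $\mathbb{Q}\Gamma_v$-upper limit topology.
   Context: $\mathrm{Zar}(K(X)|V)$ is the set of valuation domains of $K(X)$ (with quotient field $K(X)$) containing $V$; its Zariski topology is generated by the subbasic open sets $B(\phi)=\{W\mid\phi\in W\}$, $\phi\in K(X)$; subsets carry the subspace topology. A sequence $E=\{s_n\}_{n\in\mathbb{N}}$ in $K$ is pseudo-convergent if $v(s_{n+1}-s_n)<v(s_{n+2}-s_{n+1})$ for all $n$. Its breadth is $\delta_E=\lim_{n\to\infty}v(s_{n+1}-s_n)\in\mathbb{R}\cup\{\infty\}$. $V_E=\{\phi\in K(X)\mid \phi(s_n)\in V\text{ for all but finitely many }n\in\mathbb{N}\}$ is a valuation domain of $K(X)$ with $V_E\cap K=V$. $\mathcal{L}_E^u$ is the set of the $\alpha\in\overline{K}$ such that $u(\alpha-s_n)<u(\alpha-s_{n+1})$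 for all $n$ (the pseudo-limits of $E$ with respect to $u$). $\mathcal{V}^u(\beta,\bullet)$ is the set of rings $V_E$, with $E$ a pseudo-convergent sequence in $K$ such that $\beta\in\mathcal{L}_E^u$. The supremum $\delta(\beta,K)$ is an element of $\mathbb{R}\cup\{+\infty\}$ ($+\infty$ is included in the interval if $\delta(\beta,K)=+\infty$). $\mathbb{Q}\Gamma_v=\{q\gamma\mid q\in\mathbb{Q},\gamma\in\Gamma_v\}$. For $a<b$ in $\mathbb{R}\cup\{-\infty,+\infty\}$ and $\Lambda\subseteq\mathbb{R}$, the $\Lambda$-upper limit topology on $(a,b]$ is the topology generated by the sets $(\alpha,\lambda]\cap(a,b]$, for $\lambda\in\Lambda\cup\{\infty\}$ and $\alpha\in(a,b]$ (together with the whole space); the resulting space is denoted $(a,b]_\Lambda$. In particular each $(\alpha,b]$ is open. *)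

theory Defs
  imports "HOL-Analysis.Analysis" "HOL-Computational_Algebra.Polynomial_Factorial"
begin

text \<open>The fields \<open>K\<close> and \<open>L\<close> are types of class \<open>field\<close>, and \<open>K(X)\<close> is
  the type of fractions of polynomials over \<open>K\<close>. Subrings are subsets.\<close>

section \<open>Valuation domains and rank one valuations\<close>

definition subring_of_field :: "'f::field set \<Rightarrow> bool" where
  "subring_of_field R \<longleftrightarrow>
     1 \<in> R \<and> (\<forall>x\<in>R. \<forall>y\<in>R. x - y \<in> R) \<and> (\<forall>x\<in>R. \<forall>y\<in>R. x * y \<in> R)"

text \<open>The quotient field of \<open>R\<close> is the whole type \<open>'f\<close>: this is implied by
  the second condition.\<close>

definition valuation_domain :: "'f::field set \<Rightarrow> bool" where
  "valuation_domain R \<longleftrightarrow>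
     subring_of_field R \<and> (\<forall>x. x \<noteq> 0 \<longrightarrow> x \<in> R \<or> inverse x \<in> R)"

definition prime_ideal_in :: "'f::field set \<Rightarrow> 'f set \<Rightarrow> bool" where
  "prime_ideal_in R P \<longleftrightarrow>
     P \<subseteq> R \<and> 0 \<in> P \<and> (\<forall>x\<in>P. \<forall>y\<in>P. x + y \<in> P) \<and> (\<forall>r\<in>R. \<forall>x\<in>P. r * x \<in> P) \<and>
     1 \<notin> P \<and> (\<forall>x\<in>R. \<forall>y\<in>R. x * y \<in> P \<longrightarrow> x \<in> P \<or> y \<in> P)"

text \<open>The rank of a valuation domain is its Krull dimension. Since its prime ideals form
  a chain starting with the zero ideal, rank one means that there is exactly one
  nonzero prime ideal.\<close>

definition rank_one :: "'f::field set \<Rightarrow> bool" where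
  "rank_one R \<longleftrightarrow> (\<exists>!P. prime_ideal_in R P \<and> P \<noteq> {0})"

definition real_valuation :: "('f::field \<Rightarrow> ereal) \<Rightarrow> bool" where
  "real_valuation w \<longleftrightarrow>
     (\<forall>x. w x \<noteq> - \<infinity>) \<and> (\<forall>x. w x = \<infinity> \<longleftrightarrow> x = 0) \<and>
     (\<forall>x y. w (x * y) = w x + w y) \<and> (\<forall>x y. min (w x) (w y) \<le> w (x + y))"

definition valuation_ring :: "('f::field \<Rightarrow> ereal) \<Rightarrow> 'f set" where
  "valuation_ring w = {x. 0 \<le> w x}"

definition value_group :: "('f::field \<Rightarrow> ereal) \<Rightarrow> real set" where
  "value_group w = {\<gamma>. \<exists>x. x \<noteq> 0 \<and> w x = ereal \<gamma>}"

text \<open>Discreteness means that the value group is infinite cyclic.\<close>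

definition discrete_valuation :: "('f::field \<Rightarrow> ereal) \<Rightarrow> bool" where
  "discrete_valuation w \<longleftrightarrow>
     (\<exists>\<gamma>. \<gamma> \<noteq> 0 \<and> value_group w = range (\<lambda>n::int. of_int n * \<gamma>))"

definition rational_multiples :: "real set \<Rightarrow> real set" where
  "rational_multiples \<Gamma> = {of_rat q * \<gamma> | q \<gamma>. \<gamma> \<in> \<Gamma>}"

text \<open>The type \<open>'c\<close>, together with the field homomorphism \<open>\<iota>\<close>, is an
  algebraic closure of \<open>'k\<close>.\<close>

definition algebraic_closure_embedding :: "('k::field \<Rightarrow> 'c::alg_closed_field) \<Rightarrow> bool" where
  "algebraic_closure_embedding \<iota> \<longleftrightarrow>
     \<iota> 1 = 1 \<and> (\<forall>x y. \<iota> (x + y) = \<iota> x + \<iota> y) \<and> (\<forall>x y. \<iota> (x * y) = \<iota> x * \<iota> y) \<and>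
     (\<forall>\<alpha>. \<exists>p. p \<noteq> 0 \<and> poly (map_poly \<iota> p) \<alpha> = 0)"

section \<open>The Zariski topology\<close>

definition Zar :: "'k::field set \<Rightarrow> 'k poly fract set set" where
  "Zar V = {W. valuation_domain W \<and> (\<lambda>c. to_fract [:c:]) ` V \<subseteq> W}"

definition Zariski_topology :: "'k::field set \<Rightarrow> 'k poly fract set topology" where
  "Zariski_topology V = topology_generated_by (range (\<lambda>\<phi>. {W \<in> Zar V. \<phi> \<in> W}))"

section \<open>Pseudo-convergent sequences\<close>

definition pseudo_convergent :: "('k::field \<Rightarrow> ereal) \<Rightarrow> (nat \<Rightarrow> 'k) \<Rightarrow> bool" where
  "pseudo_convergent v s \<longleftrightarrow>
     (\<forall>n. v (s (Suc n) - s n) < v (s (Suc (Suc n)) - s (Suc n)))"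

definition breadth :: "('k::field \<Rightarrow> ereal) \<Rightarrow> (nat \<Rightarrow> 'k) \<Rightarrow> ereal" where
  "breadth v s = lim (\<lambda>n. v (s (Suc n) - s n))"

definition pseudo_limits ::
  "('k::field \<Rightarrow> 'c::field) \<Rightarrow> ('c \<Rightarrow> ereal) \<Rightarrow> (nat \<Rightarrow> 'k) \<Rightarrow> 'c set" where
  "pseudo_limits \<iota> u s = {\<alpha>. \<forall>n. u (\<alpha> - \<iota> (s n)) < u (\<alpha> - \<iota> (s (Suc n)))}"

text \<open>\<open>ratfun_value \<phi> c y\<close>: the rational function \<open>\<phi>\<close> is defined at \<open>c\<close>
  and has value \<open>y\<close> there.\<close>

definition ratfun_value :: "'k::field poly fract \<Rightarrow> 'k \<Rightarrow> 'k \<Rightarrow> bool" where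
  "ratfun_value \<phi> c y \<longleftrightarrow>
     (\<exists>p q. \<phi> = Fract p q \<and> poly q c \<noteq> 0 \<and> y = poly p c / poly q c)"

definition V_seq :: "'k::field set \<Rightarrow> (nat \<Rightarrow> 'k) \<Rightarrow> 'k poly fract set" where
  "V_seq V s = {\<phi>. \<forall>\<^sub>F n in sequentially. \<exists>y\<in>V. ratfun_value \<phi> (s n) y}"

definition V_pseudo_limit ::
  "('k::field \<Rightarrow> 'c::field) \<Rightarrow> 'k set \<Rightarrow> ('k \<Rightarrow> ereal) \<Rightarrow> ('c \<Rightarrow> ereal) \<Rightarrow> 'c
     \<Rightarrow> 'k poly fract set set" where
  "V_pseudo_limit \<iota> V v u \<beta> =
     {V_seq V s | s. pseudo_convergent v s \<and> \<beta> \<in> pseudo_limits \<iota> u s}"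

definition delta :: "('k::field \<Rightarrow> 'c::field) \<Rightarrow> ('c \<Rightarrow> ereal) \<Rightarrow> 'c \<Rightarrow> ereal" where
  "delta \<iota> u \<beta> = (SUP x. u (\<beta> - \<iota> x))"

section \<open>The upper limit topology\<close>

text \<open>The interval \<open>(a, b]\<close> is a set of extended reals, so that \<open>b = \<infinity>\<close>
  is included in it.\<close>

definition upper_limit_topology :: "real set \<Rightarrow> ereal \<Rightarrow> ereal \<Rightarrow> ereal topology" where
  "upper_limit_topology \<Lambda> a b = topology_generated_by
     (insert {a<..b}
        {{\<alpha><..l} \<inter> {a<..b} | \<alpha> l. \<alpha> \<in> {a<..b} \<and> l \<in> insert \<infinity> (ereal ` \<Lambda>)})"

end

theory Submission
  imports Defs
begin

text \<open>Shifting a polynomial \<open>p\<close> over \<open>K\<close> to the centre \<open>\<beta>\<close>, with \<open>p = \<Sum> a\<^sub>i (X - \<beta>)\<^sup>i\<close>, shows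
  that \<open>v (p x)\<close> is the minimum of the lines \<open>u a\<^sub>i + i t\<close> at \<open>t = u (\<beta> - x)\<close>, unless two of these lines
  cross at \<open>t\<close>. So whether \<open>p / q\<close> is integral at \<open>x\<close> depends only on \<open>t\<close>, and changes only at
  finitely many crossing points, which lie in \<open>\<rat>\<Gamma>\<^sub>v\<close> because \<open>\<Gamma>\<^sub>u\<close> does. Hence \<open>V\<^sub>E\<close> depends only
  on \<open>\<delta>\<^sub>E\<close>, and if it contains \<open>\<phi>\<close> then so do the rings of all breadths in some \<open>(t, l]\<close> with
  \<open>l\<close> the next crossing point. Conversely \<open>(X - x) / c\<close> and \<open>c / (X - x)\<^sup>k\<close> cut out the sets of
  rings of breadth greater than \<open>\<alpha>\<close> and at most \<open>l\<close>.\<close>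

section \<open>Real valuations\<close>

lemma valuation_basic:
  assumes "real_valuation w"
  shows valuation_zero: "w 0 = \<infinity>"
    and valuation_eq_infinity_iff: "w x = \<infinity> \<longleftrightarrow> x = 0"
    and valuation_not_minus_infinity: "w x \<noteq> - \<infinity>"
    and valuation_mult: "w (x * y) = w x + w y"
    and valuation_add_ge: "min (w x) (w y) \<le> w (x + y)"
  using assms by (auto simp: real_valuation_def)

lemma valuation_finite:
  assumes "real_valuation w" "x \<noteq> 0"
  obtains r where "w x = ereal r"
  using assms by (cases "w x") (auto simp: real_valuation_def)

lemma valuation_one:
  assumes "real_valuation w"
  shows "w (1 :: 'f::field) = 0"
proof -
  obtain r where r: "w 1 = ereal r"
    using assms valuation_finite[OF assms, of 1] by auto
  have "w (1 * 1) = w 1 + w 1"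
    by (rule valuation_mult[OF assms])
  thus ?thesis using r by (simp add: zero_ereal_def)
qed

lemma valuation_minus:
  assumes "real_valuation w"
  shows "w (- x :: 'f::field) = w x"
proof -
  obtain r where r: "w (- 1) = ereal r"
    using assms valuation_finite[OF assms, of "-1"] by auto
  \<comment> \<open>Since -1 squares to 1, twice its value is 0.\<close>
  have "w (- 1 * - 1) = w (- 1) + w (- 1)"
    by (rule valuation_mult[OF assms])
  hence "w (- 1) = 0"
    using r valuation_one[OF assms] by (simp add: zero_ereal_def)
  moreover have "w (- 1 * x) = w (- 1) + w x"
    by (rule valuation_mult[OF assms])
  ultimately show ?thesis by simp
qed

lemma valuation_diff_commute:
  assumes "real_valuation w"
  shows "w (x - y :: 'f::field) = w (y - x)"
  using valuation_minus[OF assms, of "x - y"] by simp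

lemma valuation_diff_ge:
  assumes "real_valuation w"
  shows "min (w x) (w y) \<le> w (x - y :: 'f::field)"
  using valuation_add_ge[OF assms, of x "- y"] valuation_minus[OF assms, of y] by simp

lemma valuation_add_less:
  assumes "real_valuation w" "w x < w y"
  shows "w (x + y :: 'f::field) = w x"
proof (rule antisym)
  show "w x \<le> w (x + y)"
    using valuation_add_ge[OF assms(1), of x y] assms(2) by simp
  \<comment> \<open>Write \<open>x\<close> as \<open>(x + y) - y\<close>. The minimum bounding
    \<open>w x\<close> from below cannot be \<open>w y\<close>, which is larger.\<close>
  show "w (x + y) \<le> w x"
    using valuation_diff_ge[OF assms(1), of "x + y" y] assms(2) by (auto simp: min_def split: if_splits)
qed

lemma valuation_diff_less:
  assumes "real_valuation w" "w x < w y"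
  shows "w (x - y :: 'f::field) = w x"
  using valuation_add_less[OF assms(1), of x "- y"] assms valuation_minus[OF assms(1), of y] by simp

lemma valuation_inverse:
  assumes "real_valuation w" "w x = ereal r"
  shows "w (inverse x :: 'f::field) = ereal (- r)"
proof -
  have x: "x \<noteq> 0"
    using assms valuation_zero[OF assms(1)] by auto
  then obtain s where s: "w (inverse x) = ereal s"
    using valuation_finite[OF assms(1), of "inverse x"] by auto
  have "w (x * inverse x) = w x + w (inverse x)"
    by (rule valuation_mult[OF assms(1)])
  thus ?thesis
    using x s assms valuation_one[OF assms(1)] by (simp add: zero_ereal_def)
qed

lemma valuation_power:
  assumes "real_valuation w" "w x = ereal r"
  shows "w (x ^ n :: 'f::field) = ereal (real n * r)"
proof (induction n)
  case 0
  show ?case using valuation_one[OF assms(1)] by (simp add: zero_ereal_def)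
next
  case (Suc n)
  thus ?case
    using valuation_mult[OF assms(1), of x "x ^ n"] assms(2) by (simp add: algebra_simps)
qed

lemma valuation_divide_nonneg_iff:
  assumes "real_valuation w" "y \<noteq> 0"
  shows "0 \<le> w (x / y :: 'f::field) \<longleftrightarrow> w y \<le> w x"
proof -
  obtain r where r: "w y = ereal r"
    using valuation_finite[OF assms] by blast
  have "w (x / y) = w x + ereal (- r)"
    using valuation_mult[OF assms(1), of x "inverse y"] valuation_inverse[OF assms(1) r]
    by (simp add: divide_inverse)
  thus ?thesis using r by (cases "w x") (auto simp: zero_ereal_def)
qed

lemma valuation_sum_gt:
  assumes "real_valuation w" "finite I" "\<And>i. i \<in> I \<Longrightarrow> a < w (f i)" "a < \<infinity>"
  shows "a < w (sum f I :: 'f::field)"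
  using assms(2,3)
proof (induction I rule: finite_induct)
  case empty
  thus ?case using valuation_zero[OF assms(1)] assms(4) by simp
next
  case (insert i I)
  hence "a < min (w (f i)) (w (sum f I))" by simp
  also have "\<dots> \<le> w (f i + sum f I)" by (rule valuation_add_ge[OF assms(1)])
  finally show ?case using insert by simp
qed

text \<open>The remaining terms sum to an element of strictly larger value, which cannot cancel the
  minimal one.\<close>

lemma valuation_sum_unique_min:
  assumes "real_valuation w" "finite I" "i \<in> I" "w (f i) < \<infinity>"
    and "\<And>j. j \<in> I \<Longrightarrow> j \<noteq> i \<Longrightarrow> w (f i) < w (f j)"
  shows "w (sum f I :: 'f::field) = w (f i)"
proof -
  have "w (f i) < w (sum f (I - {i}))"
    by (rule valuation_sum_gt[OF assms(1)]) (use assms in auto)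
  thus ?thesis
    using valuation_add_less[OF assms(1), of "f i" "sum f (I - {i})"]
    by (simp add: sum.remove[OF assms(2,3)])
qed

lemma valuation_ring_subring:
  assumes "real_valuation w"
  shows "subring_of_field (valuation_ring (w :: 'f::field \<Rightarrow> ereal))"
proof -
  have "0 \<le> w (x - y)" if "0 \<le> w x" "0 \<le> w y" for x y
    using valuation_diff_ge[OF assms, of x y] that by (auto simp: min_def split: if_splits)
  thus ?thesis
    using valuation_one[OF assms] valuation_mult[OF assms]
    by (auto simp: subring_of_field_def valuation_ring_def)
qed

section \<open>The value group\<close>

lemma value_group_diff:
  assumes "real_valuation (w :: 'f::field \<Rightarrow> ereal)" "a \<in> value_group w" "b \<in> value_group w"
  shows "a - b \<in> value_group w"
proof -
  obtain x y where "x \<noteq> 0" "w x = ereal a" "y \<noteq> 0" "w y = ereal b"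
    using assms by (auto simp: value_group_def)
  hence "w (x * inverse y) = ereal (a - b)" "x * inverse y \<noteq> 0"
    using valuation_mult[OF assms(1), of x "inverse y"] valuation_inverse[OF assms(1), of y b]
    by auto
  thus ?thesis unfolding value_group_def by blast
qed

lemma value_group_zero:
  assumes "real_valuation (w :: 'f::field \<Rightarrow> ereal)"
  shows "0 \<in> value_group w"
  using valuation_one[OF assms] by (auto simp: value_group_def zero_ereal_def intro!: exI[of _ 1])

lemma value_group_uminus:
  assumes "real_valuation (w :: 'f::field \<Rightarrow> ereal)" "a \<in> value_group w"
  shows "- a \<in> value_group w"
  using value_group_diff[OF assms(1) value_group_zero[OF assms(1)] assms(2)] by simp

lemma value_group_of_int_mult:
  assumes "real_valuation (w :: 'f::field \<Rightarrow> ereal)" "a \<in> value_group w"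
  shows "of_int k * a \<in> value_group w"
proof -
  have n: "of_nat n * a \<in> value_group w" for n
  proof (induction n)
    case 0
    show ?case using value_group_zero[OF assms(1)] by simp
  next
    case (Suc n)
    from value_group_diff[OF assms(1) this value_group_uminus[OF assms]]
    show ?case by (simp add: algebra_simps)
  qed
  show ?thesis
  proof (cases k)
    case (nonneg n)
    thus ?thesis using n[of n] by simp
  next
    case (neg n)
    hence "of_int k * a = - (of_nat (Suc n) * a)"
      by (metis minus_mult_left of_int_minus of_int_of_nat_eq)
    thus ?thesis using value_group_uminus[OF assms(1) n[of "Suc n"]] by simp
  qed
qed

text \<open>Clearing the denominator of the rational factor. The multiplier \<open>k\<close> later
  serves as the order of a pole.\<close>

lemma rational_multiples_value_group_iff:
  assumes "real_valuation (w :: 'f::field \<Rightarrow> ereal)"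
  shows "x \<in> rational_multiples (value_group w) \<longleftrightarrow> (\<exists>k>0. real k * x \<in> value_group w)"
proof
  assume "x \<in> rational_multiples (value_group w)"
  then obtain q \<gamma> where x: "x = of_rat q * \<gamma>" and \<gamma>: "\<gamma> \<in> value_group w"
    by (auto simp: rational_multiples_def)
  obtain a b where q: "quotient_of q = (a, b)" by (cases "quotient_of q")
  have b: "b > 0" and qab: "q = of_int a / of_int b"
    using quotient_of_denom_pos[OF q] quotient_of_div[OF q] by auto
  have "real (nat b) * x = of_int a * \<gamma>"
    using b by (simp add: x qab of_rat_divide)
  thus "\<exists>k>0. real k * x \<in> value_group w"
    using b value_group_of_int_mult[OF assms \<gamma>, of a] by (intro exI[of _ "nat b"]) auto
next
  assume "\<exists>k>0. real k * x \<in> value_group w"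
  then obtain k where k: "k > 0" "real k * x \<in> value_group w" by blast
  have "x = of_rat (1 / of_nat k) * (real k * x)"
    using k(1) by (simp add: of_rat_divide)
  thus "x \<in> rational_multiples (value_group w)"
    unfolding rational_multiples_def using k(2) by blast
qed

text \<open>The quotient is the abscissa at which the lines of heights \<open>a\<close>,
  \<open>b\<close> and slopes \<open>i\<close>, \<open>j\<close> meet.\<close>

lemma rational_multiples_diff_divide:
  assumes "real_valuation (w :: 'f::field \<Rightarrow> ereal)"
    and "a \<in> rational_multiples (value_group w)" "b \<in> rational_multiples (value_group w)"
    and "i \<noteq> j"
  shows "(a - b) / (real j - real i) \<in> rational_multiples (value_group w)"
proof -
  obtain k l where k: "k > 0" "real k * a \<in> value_group w"
    and l: "l > 0" "real l * b \<in> value_group w"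
    using assms by (auto simp: rational_multiples_value_group_iff)
  define s where "s = int j - int i"
  \<comment> \<open>A common multiple of both denominators and of the slope difference. The absolute
    value keeps it positive; \<open>sgn s\<close> carries the sign into the group element
    below.\<close>
  define K where "K = k * l * nat \<bar>s\<bar>"
  have s: "s \<noteq> 0" "real j - real i = of_int s" using assms(4) by (auto simp: s_def)
  have "of_int (sgn s * int l) * (real k * a) - of_int (sgn s * int k) * (real l * b)
      \<in> value_group w"
    by (intro value_group_diff[OF assms(1)] value_group_of_int_mult[OF assms(1)] k l)
  also have "of_int (sgn s * int l) * (real k * a) - of_int (sgn s * int k) * (real l * b)
      = real K * ((a - b) / (real j - real i))"
    using s by (cases "s > 0") (auto simp: K_def field_simps sgn_if)
  finally show ?thesis
    using s k l by (auto simp: rational_multiples_value_group_iff[OF assms(1)] K_def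
        intro!: exI[of _ K])
qed

text \<open>A subgroup of the reals without smallest positive element is dense.\<close>

lemma value_group_dense:
  assumes w: "real_valuation (w :: 'f::field \<Rightarrow> ereal)"
    and nontrivial: "value_group w \<noteq> {0}"
    and "\<not> discrete_valuation w" and "a < b"
  shows "\<exists>\<gamma>\<in>value_group w. a < \<gamma> \<and> \<gamma> < b"
proof -
  let ?G = "value_group w"
  define P where "P = {\<gamma>\<in>?G. 0 < \<gamma>}"
  have "P \<noteq> {}"
  proof -
    obtain \<gamma> where "\<gamma> \<in> ?G" "\<gamma> \<noteq> 0"
      using nontrivial value_group_zero[OF w] by blast
    hence "\<gamma> \<in> P \<or> - \<gamma> \<in> P"
      using value_group_uminus[OF w, of \<gamma>] by (auto simp: P_def)
    thus ?thesis by blast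
  qed
  have bdd: "bdd_below P" by (auto simp: P_def bdd_below_def intro: less_imp_le)
  \<comment> \<open>If all positive elements stayed above \<open>e\<close>, their infimum
    \<open>m\<close> would be attained and generate the group, which non-discreteness
    forbids.\<close>
  have small: "\<exists>\<gamma>\<in>P. \<gamma> < e" if "e > 0" for e
  proof (rule ccontr)
    assume no: "\<not> (\<exists>\<gamma>\<in>P. \<gamma> < e)"
    define m where "m = Inf P"
    have "e \<le> m" unfolding m_def using no \<open>P \<noteq> {}\<close> by (intro cInf_greatest) auto
    hence "m > 0" using \<open>e > 0\<close> by simp
    have ge: "m \<le> \<gamma>" if "\<gamma> \<in> P" for \<gamma>
      unfolding m_def using that bdd by (rule cInf_lower)
    have "Inf P < 2 * m" using \<open>m > 0\<close> by (simp add: m_def)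
    then obtain \<gamma> where \<gamma>: "\<gamma> \<in> P" "\<gamma> < 2 * m"
      using \<open>P \<noteq> {}\<close> bdd cInf_less_iff by metis
    \<comment> \<open>Otherwise \<open>P\<close> has a second element \<gamma>' with m \<le>
      \<gamma>' < \<gamma> < 2m, and the difference is a positive element of the group below
      \<open>m\<close>.\<close>
    have "\<gamma> = m"
    proof (rule ccontr)
      assume "\<gamma> \<noteq> m"
      hence "Inf P < \<gamma>" using ge[OF \<gamma>(1)] by (simp add: m_def)
      then obtain \<gamma>' where "\<gamma>' \<in> P" "\<gamma>' < \<gamma>"
        using \<open>P \<noteq> {}\<close> bdd cInf_less_iff by metis
      hence "\<gamma> - \<gamma>' \<in> P"
        using \<gamma> value_group_diff[OF w] by (auto simp: P_def)
      thus False using ge[of "\<gamma> - \<gamma>'"] ge[OF \<open>\<gamma>' \<in> P\<close>] \<gamma>(2) by simp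
    qed
    hence mG: "m \<in> ?G" using \<gamma>(1) by (simp add: P_def)
    have "x \<in> range (\<lambda>n::int. of_int n * m)" if "x \<in> ?G" for x
    proof -
      \<comment> \<open>Division with remainder: the remainder is in the group and in [0, m), hence
        0.\<close>
      define n where "n = \<lfloor>x / m\<rfloor>"
      have "x - of_int n * m \<in> ?G"
        by (intro value_group_diff[OF w] value_group_of_int_mult[OF w] that mG)
      moreover have "of_int n * m \<le> x" "x < (of_int n + 1) * m"
        using \<open>m > 0\<close> unfolding n_def
        by (simp_all add: pos_le_divide_eq[symmetric] pos_divide_less_eq[symmetric])
      ultimately have "x = of_int n * m"
        using ge[of "x - of_int n * m"] by (fastforce simp: P_def algebra_simps)
      thus ?thesis by blast
    qed
    hence "?G = range (\<lambda>n::int. of_int n * m)"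
      using value_group_of_int_mult[OF w mG] by blast
    moreover have "m \<noteq> 0" using \<open>m > 0\<close> by simp
    ultimately show False using assms(3) unfolding discrete_valuation_def by blast
  qed
  obtain \<gamma> where \<gamma>: "\<gamma> \<in> ?G" "0 < \<gamma>" "\<gamma> < b - a"
    using small[of "b - a"] \<open>a < b\<close> by (auto simp: P_def)
  \<comment> \<open>The first multiple of \<gamma> beyond \<open>a\<close> overshoots by at most
    \<gamma> and so stays below \<open>b\<close>.\<close>
  define n where "n = \<lfloor>a / \<gamma>\<rfloor> + 1"
  have "of_int n * \<gamma> \<le> a + \<gamma>" "a < of_int n * \<gamma>"
    using \<gamma>(2) floor_divide_lower[of \<gamma> a] floor_divide_upper[of \<gamma> a]
    by (simp_all add: n_def algebra_simps)
  thus ?thesis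
    using \<gamma> value_group_of_int_mult[OF w \<gamma>(1), of n] by force
qed

text \<open>With trivial values every nonzero element is a unit of the valuation ring, so a nonzero
  ideal would contain 1.\<close>

lemma trivial_value_group_not_rank_one:
  assumes w: "real_valuation (w :: 'f::field \<Rightarrow> ereal)" and "value_group w = {0}"
  shows "\<not> rank_one (valuation_ring w)"
proof
  assume "rank_one (valuation_ring w)"
  then obtain P where P: "prime_ideal_in (valuation_ring w) P" "P \<noteq> {0}"
    by (auto simp: rank_one_def)
  then obtain x where x: "x \<in> P" "x \<noteq> 0"
    by (auto simp: prime_ideal_in_def)
  obtain r where r: "w (inverse x) = ereal r"
    using valuation_finite[OF w, of "inverse x"] x(2) by auto
  hence "r \<in> value_group w" using x(2) by (auto simp: value_group_def intro!: exI[of _ "inverse x"])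
  hence "inverse x \<in> valuation_ring w" using r assms(2) by (simp add: valuation_ring_def zero_ereal_def)
  hence "inverse x * x \<in> P" using P(1) x(1) by (auto simp: prime_ideal_in_def)
  thus False using P(1) x(2) by (auto simp: prime_ideal_in_def)
qed

section \<open>Values of polynomials\<close>

text \<open>The lower envelope of these lines is the tropical polynomial of \<open>r\<close>, dual
  to its Newton polygon. Nonzero coefficients have finite value, so \<open>real_of_ereal\<close>
  loses nothing; keeping the index makes it the slope of the line.\<close>

definition newton_lines :: "('f::field \<Rightarrow> ereal) \<Rightarrow> 'f poly \<Rightarrow> (real \<times> nat) set" where
  "newton_lines w r = (\<lambda>i. (real_of_ereal (w (coeff r i)), i)) ` {i. coeff r i \<noteq> 0}"

definition line_at :: "real \<Rightarrow> real \<times> nat \<Rightarrow> real" where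
  "line_at t l = fst l + real (snd l) * t"

text \<open>Abscissas where lines of different slope meet. Lines of equal slope agree everywhere or
  nowhere, so their order never changes.\<close>

definition crossings :: "(real \<times> nat) set \<Rightarrow> real set" where
  "crossings F = {(fst l - fst m) / (real (snd m) - real (snd l)) | l m.
                    l \<in> F \<and> m \<in> F \<and> snd l \<noteq> snd m}"

lemma finite_crossings:
  assumes "finite F"
  shows "finite (crossings F)"
proof (rule finite_subset)
  show "crossings F \<subseteq> (\<lambda>(l, m). (fst l - fst m) / (real (snd m) - real (snd l))) ` (F \<times> F)"
    unfolding crossings_def by fast
qed (use assms in simp)

lemma finite_coeff_nonzero: "finite {i. coeff r i \<noteq> 0}"
  by (rule finite_subset[of _ "{..degree r}"]) (auto intro: le_degree)

lemma finite_newton_lines: "finite (newton_lines w r)"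
  by (simp add: newton_lines_def finite_coeff_nonzero)

lemma newton_lines_nonempty: "r \<noteq> 0 \<Longrightarrow> newton_lines w r \<noteq> {}"
  by (auto simp: newton_lines_def intro!: exI[of _ "degree r"])

lemma line_at_eqD:
  assumes "l \<in> F" "m \<in> F" "snd l \<noteq> snd m" "line_at t l = line_at t m"
  shows "t \<in> crossings F"
proof -
  have "t = (fst l - fst m) / (real (snd m) - real (snd l))"
    using assms(3,4) by (simp add: line_at_def field_simps)
  thus ?thesis using assms unfolding crossings_def by blast
qed

text \<open>Distinct lines of one polynomial have distinct slopes. The larger set \<open>F\<close>
  lets numerator and denominator share one exceptional set.\<close>

lemma inj_on_line_at:
  assumes "t \<notin> crossings F" "newton_lines w r \<subseteq> F"
  shows "inj_on (line_at t) (newton_lines w r)"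
proof (rule inj_onI)
  fix l m assume "l \<in> newton_lines w r" "m \<in> newton_lines w r" "line_at t l = line_at t m"
  moreover from this have "snd l = snd m"
    using assms line_at_eqD[of l F m t] by blast
  ultimately show "l = m" by (auto simp: newton_lines_def)
qed

text \<open>By the intermediate value theorem the difference of two lines changes sign only through
  a zero, that is, at a crossing.\<close>

lemma line_at_order_const:
  assumes "l \<in> F" "m \<in> F" "s \<le> t" "{s..t} \<inter> crossings F = {}"
  shows "line_at s l \<le> line_at s m \<longleftrightarrow> line_at t l \<le> line_at t m"
proof (cases "snd l = snd m")
  case True
  thus ?thesis by (simp add: line_at_def)
next
  case False
  define h where "h x = line_at x l - line_at x m" for x
  have cont: "\<And>a. continuous_on a h"
    unfolding h_def line_at_def by (intro continuous_intros)
  have no: "h x \<noteq> 0" if "x \<in> {s..t}" for x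
    using line_at_eqD[OF assms(1,2) False, of x] assms(4) that by (auto simp: h_def)
  have "\<not> (h s \<le> 0 \<and> 0 \<le> h t)"
    using IVT'[of h s 0 t] no assms(3) cont by fastforce
  moreover have "\<not> (h t \<le> 0 \<and> 0 \<le> h s)"
    using IVT2'[of h t 0 s] no assms(3) cont by fastforce
  ultimately show ?thesis unfolding h_def by linarith
qed

text \<open>The heights of the lines at \<open>t\<close> are the values of the terms of
  \<open>r\<close> at \<open>z\<close>. As they are distinct, the smallest term decides.\<close>

lemma valuation_poly:
  assumes w: "real_valuation w" and "r \<noteq> 0" and z: "w z = ereal t"
    and inj: "inj_on (line_at t) (newton_lines w r)"
  shows "w (poly r z) = ereal (Min (line_at t ` newton_lines w r))"
proof -
  let ?I = "{i. coeff r i \<noteq> 0}"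
  let ?l = "\<lambda>i. (real_of_ereal (w (coeff r i)), i)"
  have "poly r z = (\<Sum>i\<le>degree r. coeff r i * z ^ i)"
    by (rule poly_altdef)
  also have "\<dots> = (\<Sum>i\<in>?I. coeff r i * z ^ i)"
    by (rule sum.mono_neutral_right) (auto intro: le_degree)
  finally have sum: "poly r z = (\<Sum>i\<in>?I. coeff r i * z ^ i)" .
  have summand: "w (coeff r i * z ^ i) = ereal (line_at t (?l i))" if i: "i \<in> ?I" for i
  proof -
    obtain a where "w (coeff r i) = ereal a"
      using valuation_finite[OF w, of "coeff r i"] i by auto
    thus ?thesis
      using valuation_mult[OF w, of "coeff r i" "z ^ i"] valuation_power[OF w z, of i]
      by (simp add: line_at_def)
  qed
  have "Min (line_at t ` newton_lines w r) \<in> line_at t ` newton_lines w r"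
    by (rule Min_in) (simp_all add: finite_newton_lines newton_lines_nonempty \<open>r \<noteq> 0\<close>)
  then obtain i where i: "i \<in> ?I" and min: "Min (line_at t ` newton_lines w r) = line_at t (?l i)"
    by (auto simp: newton_lines_def)
  have "w (poly r z) = w (coeff r i * z ^ i)"
    unfolding sum
  proof (rule valuation_sum_unique_min[OF w finite_coeff_nonzero i])
    show "w (coeff r i * z ^ i) < \<infinity>" using summand[OF i] by simp
    fix j assume j: "j \<in> ?I" "j \<noteq> i"
    have "line_at t (?l i) \<le> line_at t (?l j)"
      unfolding min[symmetric] using j(1)
      by (intro Min_le finite_imageI finite_newton_lines) (auto simp: newton_lines_def)
    moreover have "line_at t (?l i) \<noteq> line_at t (?l j)"
      using inj_onD[OF inj, of "?l i" "?l j"] i j by (auto simp: newton_lines_def)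
    ultimately show "w (coeff r i * z ^ i) < w (coeff r j * z ^ j)"
      using summand[OF i] summand[OF j(1)] by simp
  qed
  thus ?thesis using summand[OF i] min by simp
qed

section \<open>Rings attached to pseudo-convergent sequences\<close>

text \<open>The value does not depend on the chosen representation: cross-multiply two of them and
  evaluate at \<open>x\<close>.\<close>

lemma ratfun_value_Fract_iff:
  assumes "poly q x \<noteq> 0"
  shows "ratfun_value (Fract p q) x y \<longleftrightarrow> y = poly p x / poly q x"
proof
  assume "ratfun_value (Fract p q) x y"
  then obtain p' q' where eq: "Fract p q = Fract p' q'" and q': "poly q' x \<noteq> 0"
    and y: "y = poly p' x / poly q' x"
    by (auto simp: ratfun_value_def)
  have "q \<noteq> 0" "q' \<noteq> 0" using assms q' by auto
  hence "p * q' = p' * q" using eq by (simp add: eq_fract)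
  hence "poly (p * q') x = poly (p' * q) x" by simp
  thus "y = poly p x / poly q x" using assms q' unfolding y by (simp add: field_simps)
qed (use assms in \<open>auto simp: ratfun_value_def\<close>)

lemma ratfun_value_diff:
  assumes "ratfun_value \<phi> x y" "ratfun_value \<psi> x z"
  shows "ratfun_value (\<phi> - \<psi>) x (y - z)"
proof -
  obtain p q where 1: "\<phi> = Fract p q" "poly q x \<noteq> 0" "y = poly p x / poly q x"
    using assms(1) by (auto simp: ratfun_value_def)
  obtain p' q' where 2: "\<psi> = Fract p' q'" "poly q' x \<noteq> 0" "z = poly p' x / poly q' x"
    using assms(2) by (auto simp: ratfun_value_def)
  have "q \<noteq> 0" "q' \<noteq> 0" using 1(2) 2(2) by auto
  hence "\<phi> - \<psi> = Fract (p * q' - p' * q) (q * q')" using 1 2 by (simp add: diff_fract)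
  moreover have "y - z = poly (p * q' - p' * q) x / poly (q * q') x"
    using 1(2) 2(2) unfolding 1(3) 2(3) by (simp add: field_simps)
  moreover have "poly (q * q') x \<noteq> 0" using 1(2) 2(2) by simp
  ultimately show ?thesis unfolding ratfun_value_def by blast
qed

lemma ratfun_value_mult:
  assumes "ratfun_value \<phi> x y" "ratfun_value \<psi> x z"
  shows "ratfun_value (\<phi> * \<psi>) x (y * z)"
proof -
  obtain p q where 1: "\<phi> = Fract p q" "poly q x \<noteq> 0" "y = poly p x / poly q x"
    using assms(1) by (auto simp: ratfun_value_def)
  obtain p' q' where 2: "\<psi> = Fract p' q'" "poly q' x \<noteq> 0" "z = poly p' x / poly q' x"
    using assms(2) by (auto simp: ratfun_value_def)
  have "\<phi> * \<psi> = Fract (p * p') (q * q')" using 1 2 by simp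
  moreover have "y * z = poly (p * p') x / poly (q * q') x" using 1 2 by simp
  moreover have "poly (q * q') x \<noteq> 0" using 1(2) 2(2) by simp
  ultimately show ?thesis unfolding ratfun_value_def by blast
qed

lemma ratfun_value_const: "ratfun_value (to_fract [:c:]) x c"
  unfolding to_fract_def ratfun_value_def by (intro exI[of _ "[:c:]"] exI[of _ 1]) simp

lemma const_mem_V_seq: "c \<in> V \<Longrightarrow> to_fract [:c:] \<in> V_seq V s"
  unfolding V_seq_def using ratfun_value_const[of c] by (auto intro!: always_eventually)

lemma V_seq_subring:
  assumes "subring_of_field V"
  shows "subring_of_field (V_seq V s)"
proof -
  have "1 \<in> V_seq V s"
    using const_mem_V_seq[of 1 V s] assms by (simp add: subring_of_field_def flip: one_pCons)
  moreover have "\<phi> - \<psi> \<in> V_seq V s" if "\<phi> \<in> V_seq V s" "\<psi> \<in> V_seq V s" for \<phi> \<psi>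
  proof -
    have "\<forall>\<^sub>F n in sequentially. (\<exists>y\<in>V. ratfun_value \<phi> (s n) y) \<and> (\<exists>y\<in>V. ratfun_value \<psi> (s n) y)"
      using that by (simp add: V_seq_def eventually_conj_iff)
    hence "\<forall>\<^sub>F n in sequentially. \<exists>y\<in>V. ratfun_value (\<phi> - \<psi>) (s n) y"
      by eventually_elim (use assms in \<open>auto simp: subring_of_field_def intro!: ratfun_value_diff\<close>)
    thus ?thesis by (simp add: V_seq_def)
  qed
  moreover have "\<phi> * \<psi> \<in> V_seq V s" if "\<phi> \<in> V_seq V s" "\<psi> \<in> V_seq V s" for \<phi> \<psi>
  proof -
    have "\<forall>\<^sub>F n in sequentially. (\<exists>y\<in>V. ratfun_value \<phi> (s n) y) \<and> (\<exists>y\<in>V. ratfun_value \<psi> (s n) y)"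
      using that by (simp add: V_seq_def eventually_conj_iff)
    hence "\<forall>\<^sub>F n in sequentially. \<exists>y\<in>V. ratfun_value (\<phi> * \<psi>) (s n) y"
      by eventually_elim (use assms in \<open>auto simp: subring_of_field_def intro!: ratfun_value_mult\<close>)
    thus ?thesis by (simp add: V_seq_def)
  qed
  ultimately show ?thesis by (auto simp: subring_of_field_def)
qed

text \<open>An injective sequence meets the finitely many roots of \<open>q\<close> only finitely
  often.\<close>

lemma eventually_poly_nonzero:
  assumes "inj s" "q \<noteq> (0 :: 'k::field poly)"
  shows "\<forall>\<^sub>F n in sequentially. poly q (s n) \<noteq> 0"
proof -
  have "finite (s -` {x. poly q x = 0})"
    using poly_roots_finite[OF assms(2)] assms(1) by (rule finite_vimageI)
  hence "\<forall>\<^sub>F n in sequentially. n \<notin> s -` {x. poly q x = 0}"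
    unfolding eventually_cofinite[symmetric] cofinite_eq_sequentially[symmetric]
    by (simp add: eventually_cofinite)
  thus ?thesis by simp
qed

text \<open>The denominator vanishes at only finitely many terms; at all others integrality of the
  quotient is a comparison of values.\<close>

lemma Fract_mem_V_seq_iff:
  assumes "real_valuation v" "inj s" "q \<noteq> 0"
  shows "Fract p q \<in> V_seq (valuation_ring v) s \<longleftrightarrow>
    (\<forall>\<^sub>F n in sequentially. v (poly q (s n)) \<le> v (poly p (s n)))"
proof -
  have "\<forall>\<^sub>F n in sequentially. (\<exists>y\<in>valuation_ring v. ratfun_value (Fract p q) (s n) y) \<longleftrightarrow>
      v (poly q (s n)) \<le> v (poly p (s n))"
    using eventually_poly_nonzero[OF assms(2,3)]
    by eventually_elim
      (simp add: ratfun_value_Fract_iff valuation_ring_def valuation_divide_nonneg_iff[OF assms(1)])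
  thus ?thesis unfolding V_seq_def by (auto elim: eventually_elim2)
qed

text \<open>Supplies a test distance \<open>t\<close> just below a breadth \<open>e\<close>, past
  every critical distance that lies below \<open>e\<close>.\<close>

lemma real_between_ereal:
  assumes "finite C" "- \<infinity> < (e :: ereal)"
  obtains t where "ereal t < e" "\<And>c. c \<in> C \<Longrightarrow> ereal c < e \<Longrightarrow> c < t"
proof -
  let ?A = "insert (- \<infinity>) (ereal ` {c\<in>C. ereal c < e})"
  have fin: "finite ?A" using assms(1) by simp
  hence "Max ?A < e" using assms(2) by (subst Max_less_iff) auto
  then obtain t where t: "Max ?A < ereal t" "ereal t < e" using ereal_dense2 by blast
  have "c < t" if "c \<in> C" "ereal c < e" for c
  proof -
    have "ereal c \<le> Max ?A" using fin that by (intro Max_ge) auto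
    hence "ereal c < ereal t" using t(1) by order
    thus ?thesis by simp
  qed
  thus thesis using t(2) that by blast
qed

text \<open>Rank one and non-discreteness enter in the form of density of the value group.\<close>

locale valued_closure =
  fixes v :: "'k::field \<Rightarrow> ereal" and \<iota> :: "'k \<Rightarrow> 'c::alg_closed_field"
    and u :: "'c \<Rightarrow> ereal" and \<beta> :: 'c
  assumes val_v: "real_valuation v"
    and val_u: "real_valuation u"
    and embedding: "algebraic_closure_embedding \<iota>"
    and extension: "u (\<iota> x) = v x"
    and dense_value_group: "a < b \<Longrightarrow> \<exists>\<gamma>\<in>value_group v. a < \<gamma> \<and> \<gamma> < b"
begin

abbreviation "V \<equiv> valuation_ring v"
abbreviation "Q\<Gamma> \<equiv> rational_multiples (value_group v)"

section \<open>The embedding into the closure and the values there\<close>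

lemma embedding_add: "\<iota> (x + y) = \<iota> x + \<iota> y"
  and embedding_mult: "\<iota> (x * y) = \<iota> x * \<iota> y"
  using embedding by (auto simp: algebraic_closure_embedding_def)

lemma embedding_zero [simp]: "\<iota> 0 = 0"
  using embedding_add[of 0 0] by (metis add_cancel_right_right)

lemma embedding_diff: "\<iota> (x - y) = \<iota> x - \<iota> y"
  using embedding_add[of "x - y" y] by simp

lemma embedding_eq_0_iff [simp]: "\<iota> x = 0 \<longleftrightarrow> x = 0"
  using extension[of x] valuation_eq_infinity_iff[OF val_v, of x]
    valuation_eq_infinity_iff[OF val_u, of "\<iota> x"] by auto

lemma embedding_poly: "\<iota> (poly p x) = poly (map_poly \<iota> p) (\<iota> x)"
  by (induction p) (simp_all add: map_poly_pCons embedding_add embedding_mult)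

lemma map_poly_embedding_eq_0_iff: "map_poly \<iota> p = 0 \<longleftrightarrow> p = 0"
  by (rule map_poly_eq_0_iff) auto

lemma value_group_subset_rational: "value_group v \<subseteq> Q\<Gamma>"
  by (force simp: rational_multiples_value_group_iff[OF val_v])

text \<open>In an algebraic equation for \<open>\<alpha>\<close> two terms must have the same value.\<close>

lemma closure_value_rational:
  assumes "u \<alpha> = ereal a"
  shows "a \<in> Q\<Gamma>"
proof -
  obtain p where "p \<noteq> 0" and root: "poly (map_poly \<iota> p) \<alpha> = 0"
    using embedding unfolding algebraic_closure_embedding_def by blast
  let ?r = "map_poly \<iota> p"
  have "?r \<noteq> 0" using \<open>p \<noteq> 0\<close> by (simp add: map_poly_embedding_eq_0_iff)
  \<comment> \<open>Distinct heights would give a finite value to the polynomial at its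
    root.\<close>
  have "\<not> inj_on (line_at a) (newton_lines u ?r)"
    using valuation_poly[OF val_u \<open>?r \<noteq> 0\<close> assms] root valuation_zero[OF val_u] by auto
  hence "a \<in> crossings (newton_lines u ?r)" using inj_on_line_at by blast
  moreover have "fst l \<in> Q\<Gamma>" if l: "l \<in> newton_lines u ?r" for l
  proof -
    obtain i where i: "coeff p i \<noteq> 0" "fst l = real_of_ereal (v (coeff p i))"
      using l by (auto simp: newton_lines_def coeff_map_poly extension)
    obtain r where "v (coeff p i) = ereal r" using valuation_finite[OF val_v i(1)] by blast
    hence "fst l \<in> value_group v" using i by (auto simp: value_group_def)
    thus ?thesis using value_group_subset_rational by blast
  qed
  ultimately show ?thesis
    by (auto simp: crossings_def intro!: rational_multiples_diff_divide[OF val_v])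
qed

lemma dense_ereal:
  assumes "a < (b :: ereal)"
  obtains c where "a < v c" "v c < b"
proof -
  \<comment> \<open>The ends may be infinite, so two real points are squeezed in before density is
    applied.\<close>
  obtain r where r: "a < ereal r" "ereal r < b" using ereal_dense2[OF assms] by blast
  obtain s where s: "ereal r < ereal s" "ereal s < b" using ereal_dense2[OF r(2)] by blast
  obtain \<gamma> where "\<gamma> \<in> value_group v" "r < \<gamma>" "\<gamma> < s"
    using dense_value_group[of r s] s by auto
  moreover then obtain c where "v c = ereal \<gamma>" by (auto simp: value_group_def)
  ultimately have "a < v c" "v c < b"
    using r s by (auto intro: less_trans[of a "ereal r"] less_trans[of _ "ereal s"])
  thus thesis by (rule that)
qed

subsection \<open>Values of rational functions near the centre\<close>

text \<open>The Taylor expansion at \<beta>: its coefficients are those of \<open>p\<close> in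
  powers of X - \<beta>.\<close>

definition shift :: "'k poly \<Rightarrow> 'c poly" where
  "shift p = pcompose (map_poly \<iota> p) [:\<beta>, 1:]"

lemma shift_eq_0: "shift p = 0 \<Longrightarrow> p = 0"
  using pcompose_eq_0[of "map_poly \<iota> p" "[:\<beta>, 1:]"]
  by (simp add: shift_def map_poly_embedding_eq_0_iff)

lemma valuation_poly_near:
  assumes "p \<noteq> 0" "u (\<beta> - \<iota> x) = ereal t" "t \<notin> crossings F" "newton_lines u (shift p) \<subseteq> F"
  shows "v (poly p x) = ereal (Min (line_at t ` newton_lines u (shift p)))"
proof -
  have "poly (shift p) (\<iota> x - \<beta>) = \<iota> (poly p x)"
    by (simp add: shift_def poly_pcompose embedding_poly)
  moreover have "u (poly (shift p) (\<iota> x - \<beta>)) = ereal (Min (line_at t ` newton_lines u (shift p)))"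
  proof (rule valuation_poly[OF val_u])
    show "shift p \<noteq> 0" using assms(1) shift_eq_0 by blast
    show "u (\<iota> x - \<beta>) = ereal t"
      using assms(2) valuation_diff_commute[OF val_u, of "\<iota> x" \<beta>] by simp
  qed (rule inj_on_line_at[OF assms(3,4)])
  ultimately show ?thesis by (simp add: extension)
qed

text \<open>\<open>P\<close> records whether \<open>p / q\<close> is integral at points at distance \<open>t\<close> from \<open>\<beta>\<close>; it can only
  change at the finitely many critical distances in \<open>C\<close>.\<close>

definition threshold :: "'k poly \<Rightarrow> 'k poly \<Rightarrow> real set \<Rightarrow> (real \<Rightarrow> bool) \<Rightarrow> bool" where
  "threshold p q C P \<longleftrightarrow> finite C \<and> C \<subseteq> Q\<Gamma> \<and>
     (\<forall>x t. u (\<beta> - \<iota> x) = ereal t \<longrightarrow> t \<notin> C \<longrightarrow> (v (poly q x) \<le> v (poly p x) \<longleftrightarrow> P t)) \<and>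
     (\<forall>s t. s \<le> t \<longrightarrow> {s..t} \<inter> C = {} \<longrightarrow> P s = P t)"

text \<open>\<open>P\<close> compares the lower envelopes of \<open>p\<close> and \<open>q\<close>,
  and \<open>C\<close> consists of all crossings of their lines. The coefficients of the shifts lie
  in the closure, whose finite values are in \<open>Q\<Gamma>\<close>, hence so are the
  crossings.\<close>

lemma threshold_exists:
  assumes "p \<noteq> 0" "q \<noteq> 0"
  shows "\<exists>C P. threshold p q C P"
proof -
  let ?A = "newton_lines u (shift p)" and ?B = "newton_lines u (shift q)"
  let ?C = "crossings (?A \<union> ?B)"
  let ?P = "\<lambda>t. Min (line_at t ` ?B) \<le> Min (line_at t ` ?A)"
  have ne: "?A \<noteq> {}" "?B \<noteq> {}"
    using assms shift_eq_0 by (auto intro!: newton_lines_nonempty)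
  \<comment> \<open>Comparing two minima reduces to comparing single lines, and that order is
    constant between crossings.\<close>
  have P_iff: "?P t \<longleftrightarrow> (\<forall>l\<in>?A. \<exists>m\<in>?B. line_at t m \<le> line_at t l)" for t
  proof -
    have "?P t \<longleftrightarrow> (\<forall>l\<in>?A. Min (line_at t ` ?B) \<le> line_at t l)"
      using ne finite_newton_lines by (subst Min_ge_iff) auto
    also have "\<dots> \<longleftrightarrow> (\<forall>l\<in>?A. \<exists>m\<in>?B. line_at t m \<le> line_at t l)"
      using ne finite_newton_lines[of u "shift q"] by (simp add: Min_le_iff)
    finally show ?thesis .
  qed
  have "threshold p q ?C ?P"
    unfolding threshold_def
  proof (intro conjI allI impI)
    show "finite ?C" by (intro finite_crossings) (simp add: finite_newton_lines)
    have "fst l \<in> Q\<Gamma>" if l: "l \<in> newton_lines u r" for l r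
    proof -
      obtain i where i: "coeff r i \<noteq> 0" "fst l = real_of_ereal (u (coeff r i))"
        using l by (auto simp: newton_lines_def)
      obtain b where "u (coeff r i) = ereal b" using valuation_finite[OF val_u i(1)] by blast
      thus ?thesis using i(2) closure_value_rational by simp
    qed
    thus "?C \<subseteq> Q\<Gamma>"
      by (auto simp: crossings_def intro!: rational_multiples_diff_divide[OF val_v])
  next
    fix x t assume "u (\<beta> - \<iota> x) = ereal t" "t \<notin> ?C"
    thus "(v (poly q x) \<le> v (poly p x)) = ?P t"
      using valuation_poly_near[OF assms(1), of x t] valuation_poly_near[OF assms(2), of x t]
      by simp
  next
    fix s t :: real assume "s \<le> t" "{s..t} \<inter> ?C = {}"
    thus "?P s = ?P t"
      unfolding P_iff using line_at_order_const[of _ "?A \<union> ?B" _ s t] by (metis UnCI)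
  qed
  thus ?thesis by blast
qed

subsection \<open>Sequences with a given pseudo-limit\<close>

abbreviation "gap s n \<equiv> u (\<beta> - \<iota> (s n))"

context
  fixes s assumes lim: "\<beta> \<in> pseudo_limits \<iota> u s"
begin

lemma gap_strict: "gap s n < gap s (Suc n)"
  using lim by (auto simp: pseudo_limits_def)

lemma gap_less: "m < n \<Longrightarrow> gap s m < gap s n"
  by (rule lift_Suc_mono_less[of "gap s"]) (rule gap_strict)

text \<open>Of \<beta> - \<open>s n\<close> and \<beta> - \<open>s (Suc n)\<close> the first has
  strictly smaller value, so it determines the value of their difference. The breadth thus becomes
  the supremum of the distances to \<beta>.\<close>

lemma gap_eq_valuation: "gap s n = v (s (Suc n) - s n)"
proof -
  have "gap s n = u ((\<beta> - \<iota> (s n)) - (\<beta> - \<iota> (s (Suc n))))"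
    using valuation_diff_less[OF val_u gap_strict] by simp
  thus ?thesis by (simp add: extension[symmetric] embedding_diff)
qed

lemma pseudo_limit_imp_pseudo_convergent: "pseudo_convergent v s"
  using gap_strict by (simp add: pseudo_convergent_def gap_eq_valuation[symmetric])

lemma gap_LIMSEQ_Sup: "gap s \<longlonglongrightarrow> (SUP n. gap s n)"
  by (intro LIMSEQ_SUP incseq_SucI less_imp_le gap_strict)

lemma breadth_eq_Sup: "breadth v s = (SUP n. gap s n)"
  unfolding breadth_def gap_eq_valuation[symmetric] by (rule limI[OF gap_LIMSEQ_Sup])

lemma gap_LIMSEQ: "gap s \<longlonglongrightarrow> breadth v s"
  using gap_LIMSEQ_Sup by (simp add: breadth_eq_Sup)

lemma gap_less_breadth: "gap s n < breadth v s"
  using gap_strict[of n] SUP_upper[of "Suc n" UNIV "gap s"] by (simp add: breadth_eq_Sup)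

lemma gap_real: obtains t where "gap s n = ereal t"
  using gap_strict[of n] valuation_not_minus_infinity[OF val_u, of "\<beta> - \<iota> (s n)"]
  by (cases "gap s n") auto

lemma breadth_mem: "breadth v s \<in> {- \<infinity><..delta \<iota> u \<beta>}"
proof -
  have "breadth v s \<le> delta \<iota> u \<beta>"
    unfolding breadth_eq_Sup delta_def by (intro SUP_least SUP_upper) simp
  moreover have "- \<infinity> < breadth v s"
    using gap_less_breadth[of 0] by (rule le_less_trans[rotated]) simp
  ultimately show ?thesis by simp
qed

lemma eventually_gap_greater: "a < breadth v s \<Longrightarrow> \<forall>\<^sub>F n in sequentially. a < gap s n"
  using order_tendstoD(1)[OF gap_LIMSEQ] .

lemma inj_pseudo_limit_sequence: "inj s"
  by (rule linorder_injI) (metis gap_less less_irrefl)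

text \<open>The gaps eventually lie between \<open>t\<close> and the breadth, where no critical
  distance remains.\<close>

lemma threshold_mem_V_seq:
  assumes th: "threshold p q C P" and "q \<noteq> 0" and t: "ereal t < breadth v s"
    and free: "\<And>c. c \<in> C \<Longrightarrow> ereal c < breadth v s \<Longrightarrow> c < t"
  shows "\<forall>\<^sub>F n in sequentially. v (poly q (s n)) \<le> v (poly p (s n)) \<longleftrightarrow> P t"
  using eventually_gap_greater[OF t]
proof eventually_elim
  case (elim n)
  obtain r where r: "gap s n = ereal r" by (rule gap_real)
  have "t < r" "ereal r < breadth v s" using elim r gap_less_breadth[of n] by auto
  have "c < t" if "c \<in> C" "c \<le> r" for c
    using free[OF that(1)] le_less_trans[of "ereal c" "ereal r" "breadth v s"]
      that(2) \<open>ereal r < breadth v s\<close> by simp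
  hence free': "{t..r} \<inter> C = {}" by force
  moreover have "r \<in> {t..r}" using \<open>t < r\<close> by simp
  ultimately have "r \<notin> C" by blast
  hence "v (poly q (s n)) \<le> v (poly p (s n)) \<longleftrightarrow> P r"
    using th r by (auto simp: threshold_def)
  also have "P r = P t"
    using th free' less_imp_le[OF \<open>t < r\<close>] unfolding threshold_def by metis
  finally show ?case .
qed

lemma Fract_mem_V_seq_threshold:
  assumes "threshold p q C P" "q \<noteq> 0" "ereal t < breadth v s"
    and "\<And>c. c \<in> C \<Longrightarrow> ereal c < breadth v s \<Longrightarrow> c < t"
  shows "Fract p q \<in> V_seq V s \<longleftrightarrow> P t"
proof -
  have "Fract p q \<in> V_seq V s \<longleftrightarrow> (\<forall>\<^sub>F n in sequentially. P t)"
    unfolding Fract_mem_V_seq_iff[OF val_v inj_pseudo_limit_sequence assms(2)]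
    using threshold_mem_V_seq[OF assms] by (rule eventually_cong)
  thus ?thesis by simp
qed

text \<open>If \<open>P t\<close> fails, the values are eventually in the opposite order, and the
  inverse fraction is integral.\<close>

lemma V_seq_valuation_domain: "valuation_domain (V_seq V s)"
  unfolding valuation_domain_def
proof (intro conjI allI impI)
  show "subring_of_field (V_seq V s)"
    by (intro V_seq_subring valuation_ring_subring val_v)
  fix \<phi> :: "'k poly fract" assume "\<phi> \<noteq> 0"
  then obtain p q where \<phi>: "\<phi> = Fract p q" and "q \<noteq> 0" "p \<noteq> 0"
    by (cases \<phi> rule: Fract_cases_nonzero) auto
  obtain C P where th: "threshold p q C P" using threshold_exists \<open>p \<noteq> 0\<close> \<open>q \<noteq> 0\<close> by blast
  obtain t where t: "ereal t < breadth v s" "\<And>c. c \<in> C \<Longrightarrow> ereal c < breadth v s \<Longrightarrow> c < t"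
    using real_between_ereal[of C "breadth v s"] th breadth_mem by (auto simp: threshold_def)
  show "\<phi> \<in> V_seq V s \<or> inverse \<phi> \<in> V_seq V s"
  proof (cases "P t")
    case True
    thus ?thesis using Fract_mem_V_seq_threshold[OF th \<open>q \<noteq> 0\<close> t] \<phi> by simp
  next
    case False
    have "\<forall>\<^sub>F n in sequentially. v (poly p (s n)) \<le> v (poly q (s n))"
      using threshold_mem_V_seq[OF th \<open>q \<noteq> 0\<close> t]
      by (rule eventually_mono) (use False in auto)
    hence "Fract q p \<in> V_seq V s"
      using Fract_mem_V_seq_iff[OF val_v inj_pseudo_limit_sequence \<open>p \<noteq> 0\<close>] by blast
    thus ?thesis using \<phi> by simp
  qed
qed

lemma V_seq_mem_Zar: "V_seq V s \<in> Zar V"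
  using V_seq_valuation_domain const_mem_V_seq by (auto simp: Zar_def)

text \<open>At \<open>s n\<close> the function X - x has value at least the minimum of
  \<open>gap s n\<close> and u(\<beta> - x), with equality if these differ. The bound on
  \<open>v c\<close> by the breadth is strict because the gaps never reach it.\<close>

lemma linear_mem_V_seq_iff:
  assumes "c \<noteq> 0"
  shows "Fract [:- x, 1:] [:c:] \<in> V_seq V s \<longleftrightarrow> v c < breadth v s \<and> v c \<le> u (\<beta> - \<iota> x)"
    (is "?L \<longleftrightarrow> ?R")
proof -
  have split: "v (s n - x) = u ((\<beta> - \<iota> x) - (\<beta> - \<iota> (s n)))" for n
    by (simp add: extension[symmetric] embedding_diff)
  have L: "?L \<longleftrightarrow> (\<forall>\<^sub>F n in sequentially. v c \<le> v (s n - x))"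
    using assms Fract_mem_V_seq_iff[OF val_v inj_pseudo_limit_sequence, of "[:c:]" "[:- x, 1:]"]
    by simp
  show ?thesis
  proof
    assume R: ?R
    have "\<forall>\<^sub>F n in sequentially. v c < gap s n" using R by (intro eventually_gap_greater) simp
    hence "\<forall>\<^sub>F n in sequentially. v c \<le> v (s n - x)"
    proof eventually_elim
      case (elim n)
      thus ?case using R valuation_diff_ge[OF val_u, of "\<beta> - \<iota> x" "\<beta> - \<iota> (s n)"]
        by (auto simp: split min_def split: if_splits)
    qed
    thus ?L using L by simp
  next
    assume ?L
    hence le: "\<forall>\<^sub>F n in sequentially. v c \<le> v (s n - x)" using L by simp
    show ?R
    \<comment> \<open>If so, the gaps eventually exceed u(\<beta> - x), which is then the value of
      \<open>s n - x\<close>; otherwise that value is the gap for every \<open>n\<close>.\<close>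
    proof (cases "u (\<beta> - \<iota> x) < breadth v s")
      case True
      from le eventually_gap_greater[OF True] have "\<forall>\<^sub>F n in sequentially. v c \<le> u (\<beta> - \<iota> x)"
        by eventually_elim (metis split valuation_diff_less[OF val_u])
      thus ?R using True by simp
    next
      case False
      have "v (s n - x) = gap s n" for n
        using valuation_diff_less[OF val_u, of "\<beta> - \<iota> (s n)" "\<beta> - \<iota> x"] gap_less_breadth[of n] False
          valuation_diff_commute[OF val_u, of "\<beta> - \<iota> x" "\<beta> - \<iota> (s n)"] by (simp add: split)
      hence "\<forall>\<^sub>F n in sequentially. v c \<le> gap s n" using le by simp
      then obtain n where "v c \<le> gap s n" by (auto simp: eventually_sequentially)
      hence "v c < breadth v s" using gap_less_breadth[of n] by order
      thus ?R using False by auto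
    qed
  qed
qed

text \<open>The order \<open>k\<close> makes up for \<open>l\<close> possibly lying outside the
  value group. As \<open>x\<close> is closer to \<beta> than \<open>l\<close>, comparing the value
  of \<open>s n - x\<close> with \<open>l\<close> amounts to comparing the gap with
  \<open>l\<close>.\<close>

lemma pole_mem_V_seq_iff:
  assumes "k > 0" "v c = ereal (real k * l)" "ereal l < u (\<beta> - \<iota> x)"
  shows "Fract [:c:] ([:- x, 1:] ^ k) \<in> V_seq V s \<longleftrightarrow> breadth v s \<le> ereal l"
    (is "?L \<longleftrightarrow> ?R")
proof -
  have split: "v (s n - x) = u ((\<beta> - \<iota> x) - (\<beta> - \<iota> (s n)))" for n
    by (simp add: extension[symmetric] embedding_diff)
  have le_iff: "v ((s n - x) ^ k) \<le> v c \<longleftrightarrow> v (s n - x) \<le> ereal l" for n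
  proof (cases "v (s n - x)")
    case (real r)
    thus ?thesis using valuation_power[OF val_v real, of k] assms by simp
  next
    \<comment> \<open>Here \<open>x\<close> is a term of the sequence, and both sides fail: the
      power is 0, of infinite value, while \<open>v c\<close> and \<open>l\<close> are
      finite.\<close>
    case PInf
    hence "s n - x = 0" using valuation_eq_infinity_iff[OF val_v] by blast
    thus ?thesis using PInf assms valuation_zero[OF val_v] by (simp add: zero_power)
  qed (use valuation_not_minus_infinity[OF val_v] in auto)
  have L: "?L \<longleftrightarrow> (\<forall>\<^sub>F n in sequentially. v (s n - x) \<le> ereal l)"
    using Fract_mem_V_seq_iff[OF val_v inj_pseudo_limit_sequence, of "[:- x, 1:] ^ k" "[:c:]"] le_iff
    by (simp add: poly_power)
  show ?thesis
  proof
    assume ?R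
    have "v (s n - x) = gap s n" for n
    proof -
      have "gap s n < u (\<beta> - \<iota> x)" using gap_less_breadth[of n] \<open>?R\<close> assms(3) by order
      thus ?thesis
        using valuation_diff_less[OF val_u, of "\<beta> - \<iota> (s n)" "\<beta> - \<iota> x"]
          valuation_diff_commute[OF val_u, of "\<beta> - \<iota> x" "\<beta> - \<iota> (s n)"] by (simp add: split)
    qed
    moreover have "gap s n \<le> ereal l" for n using gap_less_breadth[of n] \<open>?R\<close> by order
    ultimately show ?L using L by simp
  next
    assume ?L
    show ?R
    proof (rule ccontr)
      assume "\<not> ?R"
      hence "\<forall>\<^sub>F n in sequentially. ereal l < gap s n" by (intro eventually_gap_greater) simp
      moreover have "\<forall>\<^sub>F n in sequentially. v (s n - x) \<le> ereal l" using L \<open>?L\<close> by simp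
      ultimately have "\<forall>\<^sub>F n in sequentially. False"
      proof eventually_elim
        case (elim n)
        have "min (u (\<beta> - \<iota> x)) (gap s n) \<le> ereal l"
          using valuation_diff_ge[OF val_u, of "\<beta> - \<iota> x" "\<beta> - \<iota> (s n)"] elim(2)
          by (simp add: split)
        thus False using elim(1) assms(3) by (auto simp: min_def split: if_splits)
      qed
      thus False by simp
    qed
  qed
qed

end

section \<open>Prescribed distances and breadths\<close>

lemma point_between:
  assumes "a < e" "e \<le> delta \<iota> u \<beta>"
  obtains x where "a < u (\<beta> - \<iota> x)" "u (\<beta> - \<iota> x) < e"
proof (cases "\<exists>x. e \<le> u (\<beta> - \<iota> x)")
  case True
  then obtain x where x: "e \<le> u (\<beta> - \<iota> x)" by blast
  \<comment> \<open>A point too close to \<beta> is moved away by \<open>c\<close>: the distance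
    from \<beta> to \<open>x + c\<close> is then exactly \<open>v c\<close>.\<close>
  obtain c where c: "a < v c" "v c < e" by (rule dense_ereal[OF assms(1)])
  have "u (\<iota> c - (\<beta> - \<iota> x)) = v c"
    using valuation_diff_less[OF val_u, of "\<iota> c" "\<beta> - \<iota> x"] c x by (simp add: extension)
  hence "u (\<beta> - \<iota> (x + c)) = v c"
    using valuation_diff_commute[OF val_u, of "\<iota> c" "\<beta> - \<iota> x"]
    by (simp add: embedding_add algebra_simps)
  thus thesis using c that by metis
next
  case False
  have "a < delta \<iota> u \<beta>" using assms by order
  then obtain x where "a < u (\<beta> - \<iota> x)" by (auto simp: delta_def less_SUP_iff)
  thus thesis using False that not_le by blast
qed

text \<open>Points are chosen one after another, with increasing distances squeezed between reals
  \<open>y n\<close> tending to \<open>e\<close> and \<open>e\<close> itself.\<close>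

lemma breadth_surj:
  assumes "e \<in> {- \<infinity><..delta \<iota> u \<beta>}"
  obtains s where "\<beta> \<in> pseudo_limits \<iota> u s" "breadth v s = e"
proof -
  obtain y :: "nat \<Rightarrow> real" where y: "\<And>n. ereal (y n) < e" "(\<lambda>n. ereal (y n)) \<longlonglongrightarrow> e"
    using ereal_incseq_approx[of "- \<infinity>" e] assms by (metis greaterThanAtMost_iff)
  let ?P = "\<lambda>n x. ereal (y n) < u (\<beta> - \<iota> x) \<and> u (\<beta> - \<iota> x) < e"
  have "\<exists>s. \<forall>n. ?P n (s n) \<and> u (\<beta> - \<iota> (s n)) < u (\<beta> - \<iota> (s (Suc n)))"
  proof (rule dependent_nat_choice)
    show "\<exists>x. ?P 0 x" using point_between[OF y(1)] assms by (metis greaterThanAtMost_iff)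
  next
    fix x n assume "?P n x"
    \<comment> \<open>The next point must pass both the last distance and the next approximation of
      \<open>e\<close>.\<close>
    hence "max (ereal (y (Suc n))) (u (\<beta> - \<iota> x)) < e" using y(1) by simp
    then obtain x' where "max (ereal (y (Suc n))) (u (\<beta> - \<iota> x)) < u (\<beta> - \<iota> x')" "u (\<beta> - \<iota> x') < e"
      using point_between assms by (metis greaterThanAtMost_iff)
    thus "\<exists>x'. ?P (Suc n) x' \<and> u (\<beta> - \<iota> x) < u (\<beta> - \<iota> x')" by auto
  qed
  then obtain s where s: "\<And>n. ?P n (s n)" "\<And>n. gap s n < gap s (Suc n)" by blast
  have lim: "\<beta> \<in> pseudo_limits \<iota> u s" using s(2) by (auto simp: pseudo_limits_def)
  have "gap s \<longlonglongrightarrow> e"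
    by (rule tendsto_sandwich[OF _ _ y(2) tendsto_const[of e]])
      (use s(1) in \<open>auto intro!: always_eventually less_imp_le\<close>)
  hence "breadth v s = e" using gap_LIMSEQ[OF lim] LIMSEQ_unique by blast
  thus thesis using lim that by blast
qed

text \<open>The test distance \<open>t\<close> depends on the breadth alone, so one
  \<open>P t\<close> decides membership in both rings. The zero function lies in every such ring and
  is treated apart.\<close>

lemma V_seq_eq_if_breadth_eq:
  assumes s: "\<beta> \<in> pseudo_limits \<iota> u s" and s': "\<beta> \<in> pseudo_limits \<iota> u s'"
    and eq: "breadth v s = breadth v s'"
  shows "V_seq V s = V_seq V s'"
proof (rule set_eqI)
  fix \<phi> :: "'k poly fract"
  have zero: "0 \<in> V_seq V r" for r
    using const_mem_V_seq[of 0 V r] valuation_zero[OF val_v] by (simp add: valuation_ring_def)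
  show "\<phi> \<in> V_seq V s \<longleftrightarrow> \<phi> \<in> V_seq V s'"
  proof (cases \<phi> rule: Fract_cases_nonzero)
    case (Fract p q)
    obtain C P where th: "threshold p q C P" using threshold_exists Fract by blast
    obtain t where t: "ereal t < breadth v s" "\<And>c. c \<in> C \<Longrightarrow> ereal c < breadth v s \<Longrightarrow> c < t"
      using real_between_ereal[of C "breadth v s"] th breadth_mem[OF s] by (auto simp: threshold_def)
    have "\<phi> \<in> V_seq V s \<longleftrightarrow> P t"
      unfolding Fract(1) by (rule Fract_mem_V_seq_threshold[OF s th Fract(2) t])
    moreover have "\<phi> \<in> V_seq V s' \<longleftrightarrow> P t"
      unfolding Fract(1) by (rule Fract_mem_V_seq_threshold[OF s' th Fract(2) t[unfolded eq]])
    ultimately show ?thesis by simp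
  qed (simp add: zero)
qed

text \<open>If one breadth is smaller, choose \<open>x\<close> at a distance strictly between the
  two and \<open>v c\<close> between the smaller breadth and that distance: then (X - x) / c is only
  in the ring of larger breadth.\<close>

lemma breadth_eq_if_V_seq_eq:
  assumes s: "\<beta> \<in> pseudo_limits \<iota> u s" and s': "\<beta> \<in> pseudo_limits \<iota> u s'"
    and eq: "V_seq V s = V_seq V s'"
  shows "breadth v s = breadth v s'"
proof -
  have "\<not> breadth v r < breadth v r'"
    if r: "\<beta> \<in> pseudo_limits \<iota> u r" and r': "\<beta> \<in> pseudo_limits \<iota> u r'"
      and eq: "V_seq V r = V_seq V r'" for r r'
  proof
    assume less: "breadth v r < breadth v r'"
    obtain x where x: "breadth v r < u (\<beta> - \<iota> x)" "u (\<beta> - \<iota> x) < breadth v r'"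
      by (rule point_between[OF less]) (use breadth_mem[OF r'] in auto)
    obtain c where c: "breadth v r < v c" "v c < u (\<beta> - \<iota> x)" by (rule dense_ereal[OF x(1)])
    hence "c \<noteq> 0" using valuation_zero[OF val_v] by auto
    have "Fract [:- x, 1:] [:c:] \<notin> V_seq V r"
      unfolding linear_mem_V_seq_iff[OF r \<open>c \<noteq> 0\<close>] using c(1) by auto
    moreover have "Fract [:- x, 1:] [:c:] \<in> V_seq V r'"
      unfolding linear_mem_V_seq_iff[OF r' \<open>c \<noteq> 0\<close>] using c(2) x(2) by auto
    ultimately show False unfolding eq by blast
  qed
  from this[OF s s' eq] this[OF s' s eq[symmetric]] show ?thesis by order
qed

subsection \<open>The homeomorphism\<close>

abbreviation "rings \<equiv> V_pseudo_limit \<iota> V v u \<beta>"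
abbreviation "interval \<equiv> {- \<infinity><..delta \<iota> u \<beta>}"
abbreviation "rings_topology \<equiv> subtopology (Zariski_topology V) rings"
abbreviation "interval_topology \<equiv> upper_limit_topology Q\<Gamma> (- \<infinity>) (delta \<iota> u \<beta>)"

lemma V_pseudo_limit_eq: "rings = {V_seq V s | s. \<beta> \<in> pseudo_limits \<iota> u s}"
  unfolding V_pseudo_limit_def using pseudo_limit_imp_pseudo_convergent by blast

lemma rings_subset_Zar: "rings \<subseteq> Zar V"
  unfolding V_pseudo_limit_eq using V_seq_mem_Zar by blast

text \<open>The map \<Sigma> of the theorem, with \<open>breadth_ring\<close> as its inverse. Since
  ring and breadth determine each other, the choice of the sequence is immaterial on
  \<open>rings\<close> and on \<open>interval\<close>.\<close>

definition ring_breadth :: "'k poly fract set \<Rightarrow> ereal" where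
  "ring_breadth W = breadth v (SOME s. \<beta> \<in> pseudo_limits \<iota> u s \<and> W = V_seq V s)"

definition breadth_ring :: "ereal \<Rightarrow> 'k poly fract set" where
  "breadth_ring e = V_seq V (SOME s. \<beta> \<in> pseudo_limits \<iota> u s \<and> breadth v s = e)"

lemma ring_breadth_V_seq:
  assumes "\<beta> \<in> pseudo_limits \<iota> u s"
  shows "ring_breadth (V_seq V s) = breadth v s"
proof -
  let ?P = "\<lambda>r. \<beta> \<in> pseudo_limits \<iota> u r \<and> V_seq V s = V_seq V r"
  have "?P (SOME r. ?P r)" using assms by (intro someI[of ?P s]) simp
  thus ?thesis
    unfolding ring_breadth_def using breadth_eq_if_V_seq_eq[OF assms] by metis
qed

lemma breadth_ring_breadth:
  assumes "\<beta> \<in> pseudo_limits \<iota> u s"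
  shows "breadth_ring (breadth v s) = V_seq V s"
proof -
  let ?P = "\<lambda>r. \<beta> \<in> pseudo_limits \<iota> u r \<and> breadth v r = breadth v s"
  have "?P (SOME r. ?P r)" using assms by (intro someI[of ?P s]) simp
  thus ?thesis
    unfolding breadth_ring_def using V_seq_eq_if_breadth_eq assms by metis
qed

section \<open>Open sets of rings described by their breadths\<close>

lemma one_mem_Zar: "W \<in> Zar V \<Longrightarrow> 1 \<in> W"
  by (simp add: Zar_def valuation_domain_def subring_of_field_def)

lemma topspace_Zariski: "topspace (Zariski_topology V) = Zar V"
  using one_mem_Zar by (auto simp: Zariski_topology_def)

lemma topspace_rings: "topspace rings_topology = rings"
  using rings_subset_Zar by (auto simp: topspace_Zariski)

lemma topspace_interval: "topspace interval_topology = interval"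
  by (auto simp: upper_limit_topology_def)

lemma openin_rings_mem: "openin rings_topology {W \<in> rings. \<phi> \<in> W}"
proof -
  have "openin (Zariski_topology V) {W \<in> Zar V. \<phi> \<in> W}"
    unfolding Zariski_topology_def by (rule topology_generated_by_Basis) blast
  moreover have "{W \<in> rings. \<phi> \<in> W} = {W \<in> Zar V. \<phi> \<in> W} \<inter> rings"
    using rings_subset_Zar by blast
  ultimately show ?thesis unfolding openin_subtopology by blast
qed

lemma openin_rings_breadth_greater: "openin rings_topology {W \<in> rings. a < ring_breadth W}"
proof (subst openin_subopen, intro ballI)
  fix W assume "W \<in> {W \<in> rings. a < ring_breadth W}"
  then obtain s where s: "\<beta> \<in> pseudo_limits \<iota> u s" and W: "W = V_seq V s" and a: "a < breadth v s"
    using ring_breadth_V_seq by (auto simp: V_pseudo_limit_eq)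
  \<comment> \<open>With a < v c < u(\<beta> - x) < breadth, the function (X - x) / c is in
    \<open>W\<close>, and any ring containing it has breadth above \<open>v c\<close>, hence above
    \<open>a\<close>.\<close>
  obtain x where x: "a < u (\<beta> - \<iota> x)" "u (\<beta> - \<iota> x) < breadth v s"
    by (rule point_between[OF a]) (use breadth_mem[OF s] in auto)
  obtain c where c: "a < v c" "v c < u (\<beta> - \<iota> x)" by (rule dense_ereal[OF x(1)])
  hence "c \<noteq> 0" using valuation_zero[OF val_v] by auto
  note iff = linear_mem_V_seq_iff[OF _ this, of _ x]
  let ?O = "{W \<in> rings. Fract [:- x, 1:] [:c:] \<in> W}"
  have "W \<in> ?O"
    using s c(2) x(2) iff[OF s] unfolding W V_pseudo_limit_eq by auto
  moreover have "?O \<subseteq> {W \<in> rings. a < ring_breadth W}"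
  proof
    fix W' assume "W' \<in> ?O"
    then obtain r where r: "\<beta> \<in> pseudo_limits \<iota> u r" and W': "W' = V_seq V r"
      and mem: "Fract [:- x, 1:] [:c:] \<in> V_seq V r" and "W' \<in> rings"
      by (auto simp: V_pseudo_limit_eq)
    have "a < ring_breadth W'"
      using c(1) mem unfolding W' ring_breadth_V_seq[OF r] iff[OF r] by auto
    thus "W' \<in> {W \<in> rings. a < ring_breadth W}" using \<open>W' \<in> rings\<close> by simp
  qed
  ultimately show "\<exists>T. openin rings_topology T \<and> W \<in> T \<and> T \<subseteq> {W \<in> rings. a < ring_breadth W}"
    using openin_rings_mem by blast
qed

text \<open>For \<open>l\<close> below \<open>delta\<close> some \<open>x\<close> is closer to
  \<beta> than \<open>l\<close>, and a function with its pole at \<open>x\<close> cuts out the set.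
  For all other \<open>l\<close> the set is the whole space.\<close>

lemma openin_rings_breadth_le:
  assumes "l \<in> Q\<Gamma>"
  shows "openin rings_topology {W \<in> rings. ring_breadth W \<le> ereal l}"
proof (cases "ereal l < delta \<iota> u \<beta>")
  case True
  then obtain x where x: "ereal l < u (\<beta> - \<iota> x)" by (auto simp: delta_def less_SUP_iff)
  obtain k where k: "k > 0" "real k * l \<in> value_group v"
    using assms by (auto simp: rational_multiples_value_group_iff[OF val_v])
  then obtain c where c: "v c = ereal (real k * l)" by (auto simp: value_group_def)
  have "{W \<in> rings. ring_breadth W \<le> ereal l} = {W \<in> rings. Fract [:c:] ([:- x, 1:] ^ k) \<in> W}"
    unfolding V_pseudo_limit_eq using ring_breadth_V_seq pole_mem_V_seq_iff[OF _ k(1) c x] by auto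
  thus ?thesis using openin_rings_mem by simp
next
  case False
  have "{W \<in> rings. ring_breadth W \<le> ereal l} = rings"
  proof -
    have "breadth v s \<le> ereal l" if "\<beta> \<in> pseudo_limits \<iota> u s" for s
      using breadth_mem[OF that] False by auto
    thus ?thesis using ring_breadth_V_seq by (auto simp: V_pseudo_limit_eq)
  qed
  thus ?thesis using openin_topspace[of rings_topology] by (simp only: topspace_rings)
qed

section \<open>Continuity of the breadth map and of its inverse\<close>

lemma ring_breadth_mem: "W \<in> rings \<Longrightarrow> ring_breadth W \<in> interval"
  using ring_breadth_V_seq breadth_mem by (force simp: V_pseudo_limit_eq)

text \<open>A generating set bounds the breadth below by \<alpha> and above by an element of
  \<open>Q\<Gamma>\<close> or by \<infinity>, so its preimage is an intersection of the two kinds of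
  open sets above.\<close>

lemma continuous_ring_breadth: "continuous_map rings_topology interval_topology ring_breadth"
  unfolding upper_limit_topology_def
proof (rule continuous_on_generated_topo)
  show "ring_breadth ` topspace rings_topology \<subseteq> \<Union> (insert interval
      {{\<alpha><..l} \<inter> interval |\<alpha> l. \<alpha> \<in> interval \<and> l \<in> insert \<infinity> (ereal ` Q\<Gamma>)})"
    using ring_breadth_mem unfolding topspace_rings by blast
next
  fix U assume U: "U \<in> insert interval
      {{\<alpha><..l} \<inter> interval |\<alpha> l. \<alpha> \<in> interval \<and> l \<in> insert \<infinity> (ereal ` Q\<Gamma>)}"
  have whole: "openin rings_topology rings"
    using openin_topspace[of rings_topology] by (simp only: topspace_rings)
  show "openin rings_topology (ring_breadth -` U \<inter> topspace rings_topology)"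
  proof (cases "U = interval")
    case True
    hence "ring_breadth -` U \<inter> topspace rings_topology = rings"
      using ring_breadth_mem unfolding topspace_rings by blast
    thus ?thesis using whole by simp
  next
    case False
    with U obtain \<alpha> l where U: "U = {\<alpha><..l} \<inter> interval" and l: "l \<in> insert \<infinity> (ereal ` Q\<Gamma>)"
      by blast
    have "ring_breadth -` U \<inter> topspace rings_topology =
        {W \<in> rings. \<alpha> < ring_breadth W} \<inter> {W \<in> rings. ring_breadth W \<le> l}"
      unfolding topspace_rings U using ring_breadth_mem by auto
    moreover have "openin rings_topology {W \<in> rings. ring_breadth W \<le> l}"
      using l openin_rings_breadth_le whole by auto
    ultimately show ?thesis by (simp add: openin_Int openin_rings_breadth_greater)
  qed
qed

text \<open>The ring attached to \<open>e\<close> contains \<open>\<phi>\<close> iff \<open>\<phi>\<close> is integral at distances just below \<open>e\<close>; this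
  does not change while \<open>e\<close> moves up to the next critical distance \<open>l\<close>.\<close>

lemma openin_interval_mem: "openin interval_topology {e \<in> interval. \<phi> \<in> breadth_ring e}"
proof (cases \<phi> rule: Fract_cases_nonzero)
  case (Fract p q)
  obtain C P where th: "threshold p q C P" using threshold_exists Fract by blast
  have C: "finite C" "C \<subseteq> Q\<Gamma>" using th by (auto simp: threshold_def)
  have mem_iff: "\<phi> \<in> breadth_ring e \<longleftrightarrow> P t"
    if e: "e \<in> interval" "ereal t < e" "\<And>c. c \<in> C \<Longrightarrow> ereal c < e \<Longrightarrow> c < t" for e t
  proof -
    obtain s where s: "\<beta> \<in> pseudo_limits \<iota> u s" "e = breadth v s"
      using breadth_surj[OF e(1)] by metis
    show ?thesis
      unfolding Fract(1) s(2) breadth_ring_breadth[OF s(1)]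
      by (rule Fract_mem_V_seq_threshold[OF s(1) th Fract(2)]) (use e s(2) in auto)
  qed
  show ?thesis
  proof (subst openin_subopen, intro ballI)
    fix e assume "e \<in> {e \<in> interval. \<phi> \<in> breadth_ring e}"
    hence e: "e \<in> interval" "\<phi> \<in> breadth_ring e" by auto
    obtain t where t: "ereal t < e" "\<And>c. c \<in> C \<Longrightarrow> ereal c < e \<Longrightarrow> c < t"
      using real_between_ereal[of C e] C e by auto
    have "P t" using mem_iff[OF e(1) t] e(2) by simp
    \<comment> \<open>The next critical distance at or above \<open>e\<close>, or \<infinity> if
      there is none. If \<open>e\<close> itself is critical, then l = e.\<close>
    let ?A = "insert \<infinity> (ereal ` {c \<in> C. e \<le> ereal c})"
    define l where "l = Min ?A"
    have fin: "finite ?A" using C by simp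
    have l_mem: "l \<in> ?A" unfolding l_def by (rule Min_in) (use fin in auto)
    hence "l \<in> insert \<infinity> (ereal ` Q\<Gamma>)" using C by auto
    moreover have "e \<le> l" using l_mem by auto
    moreover have "ereal t \<in> interval" using t(1) e(1) by auto
    ultimately have "openin interval_topology ({ereal t<..l} \<inter> interval)"
      unfolding upper_limit_topology_def by (intro topology_generated_by_Basis) blast
    moreover have "e \<in> {ereal t<..l} \<inter> interval" using e(1) t(1) \<open>e \<le> l\<close> by simp
    moreover have "{ereal t<..l} \<inter> interval \<subseteq> {e \<in> interval. \<phi> \<in> breadth_ring e}"
    proof
      fix e' assume e': "e' \<in> {ereal t<..l} \<inter> interval"
      \<comment> \<open>A critical distance from \<open>e\<close> on is at least \<open>l\<close>,
        hence at least \<open>e'\<close>. So those below \<open>e'\<close> are already below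
        \<open>e\<close>, and \<open>t\<close> also tests \<open>e'\<close>.\<close>
      have "c < t" if "c \<in> C" "ereal c < e'" for c
      proof (rule t(2)[OF that(1)], rule ccontr)
        assume "\<not> ereal c < e"
        hence "l \<le> ereal c" unfolding l_def using fin that(1) by (intro Min_le) auto
        thus False using that(2) e' by auto
      qed
      hence "\<phi> \<in> breadth_ring e'"
        using mem_iff[of e' t] \<open>P t\<close> e' by (metis IntD1 IntD2 greaterThanAtMost_iff)
      thus "e' \<in> {e \<in> interval. \<phi> \<in> breadth_ring e}" using e' by blast
    qed
    ultimately show "\<exists>T. openin interval_topology T \<and> e \<in> T \<and>
        T \<subseteq> {e \<in> interval. \<phi> \<in> breadth_ring e}" by blast
  qed
next
  case 0
  have "0 \<in> breadth_ring e" for e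
    unfolding breadth_ring_def
    using const_mem_V_seq[of 0 V] valuation_zero[OF val_v] by (simp add: valuation_ring_def)
  hence "{e \<in> interval. \<phi> \<in> breadth_ring e} = interval" using 0 by auto
  thus ?thesis using openin_topspace[of interval_topology] by (simp only: topspace_interval)
qed

lemma breadth_ring_mem: "e \<in> interval \<Longrightarrow> breadth_ring e \<in> rings"
  by (erule breadth_surj) (auto simp: V_pseudo_limit_eq breadth_ring_breadth)

lemma continuous_breadth_ring: "continuous_map interval_topology rings_topology breadth_ring"
  unfolding continuous_map_in_subtopology
proof
  show "breadth_ring \<in> topspace interval_topology \<rightarrow> rings"
    using breadth_ring_mem by (auto simp: topspace_interval)
  show "continuous_map interval_topology (Zariski_topology V) breadth_ring"
    unfolding Zariski_topology_def
  proof (rule continuous_on_generated_topo)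
    show "breadth_ring ` topspace interval_topology \<subseteq> (\<Union>\<phi>. {W \<in> Zar V. \<phi> \<in> W})"
      using breadth_ring_mem rings_subset_Zar one_mem_Zar by (fastforce simp: topspace_interval)
  next
    fix U assume "U \<in> range (\<lambda>\<phi>. {W \<in> Zar V. \<phi> \<in> W})"
    then obtain \<phi> where U: "U = {W \<in> Zar V. \<phi> \<in> W}" by blast
    have "breadth_ring -` U \<inter> topspace interval_topology = {e \<in> interval. \<phi> \<in> breadth_ring e}"
      unfolding U topspace_interval using breadth_ring_mem rings_subset_Zar by blast
    thus "openin interval_topology (breadth_ring -` U \<inter> topspace interval_topology)"
      using openin_interval_mem by simp
  qed
qed

lemma homeomorphic_maps_breadth:
  "homeomorphic_maps rings_topology interval_topology ring_breadth breadth_ring"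
proof -
  have "breadth_ring (ring_breadth W) = W" if "W \<in> rings" for W
    using that by (auto simp: V_pseudo_limit_eq ring_breadth_V_seq breadth_ring_breadth)
  moreover have "ring_breadth (breadth_ring e) = e" if "e \<in> interval" for e
    using that by (elim breadth_surj) (auto simp: ring_breadth_V_seq breadth_ring_breadth)
  ultimately show ?thesis
    using continuous_ring_breadth continuous_breadth_ring
    unfolding homeomorphic_maps_def topspace_rings topspace_interval by blast
qed

end

theorem theorem4p4:
  fixes V :: "'k::field set"
    and v :: "'k \<Rightarrow> ereal"
    and \<iota> :: "'k \<Rightarrow> 'c::alg_closed_field"
    and u :: "'c \<Rightarrow> ereal"
    and \<beta> :: 'c
  assumes "valuation_domain V"
    and "rank_one V"
    and "real_valuation v"
    and "V = valuation_ring v"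
    and "\<not> discrete_valuation v"
    and "algebraic_closure_embedding \<iota>"
    and "real_valuation u"
    and "\<And>x. u (\<iota> x) = v x"
  shows "\<exists>\<Sigma>. (\<forall>s. pseudo_convergent v s \<and> \<beta> \<in> pseudo_limits \<iota> u s \<longrightarrow>
                \<Sigma> (V_seq V s) = breadth v s) \<and>
             V_pseudo_limit \<iota> V v u \<beta> \<subseteq> Zar V \<and>
             homeomorphic_map
               (subtopology (Zariski_topology V) (V_pseudo_limit \<iota> V v u \<beta>))
               (upper_limit_topology (rational_multiples (value_group v)) (- \<infinity>) (delta \<iota> u \<beta>))
               \<Sigma>"
proof -
  \<comment> \<open>Rank one excludes the trivial valuation, so non-discreteness yields
    density.\<close>
  have "value_group v \<noteq> {0}"
    using trivial_value_group_not_rank_one assms(2-4) by blast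
  interpret valued_closure v \<iota> u \<beta>
    by unfold_locales (use assms value_group_dense[OF assms(3) \<open>value_group v \<noteq> {0}\<close>] in auto)
  show ?thesis
    unfolding assms(4)
    using ring_breadth_V_seq rings_subset_Zar homeomorphic_maps_breadth
    by (auto simp: homeomorphic_map_maps intro!: exI[of _ ring_breadth])
qed

end
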